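(* Let $p_A,p_B\in(0,1)$, $q_A=1-p_A$, $q_B=1-p_B$, and let $J=2$. Let $h\ge 1$, let $r_1,\dots,r_h,s_1,\dots,s_h$ be positive integers, put $r=\sum_{k=1}^h r_k$, $s=\sum_{k=1}^h s_k$, and let $D$ be the nonrandom periodic pattern strategy $$D=A^{r_1}B^{s_1}A^{r_2}B^{s_2}\cdots A^{r_h}B^{s_h}.$$ Define $b_{2k-1}=(-1)^{r_k}q_A^{r_k}$ and $b_{2k}=(-1)^{s_k}q_B^{s_k}$ for $1\le k\le h$, and extend by $b_{i+2h}=b_i$ to all $i\in\mathbb Z$. Then the casino's asymptotic profit per coup $R_D$ attributable to the two-armed feature of the machine is $$R_D=2QS,$$ where $$Q=h+\sum_{m=1}^{2h}\sum_{j=1}^{2h-1}(-1)^j\prod_{i=m}^{m+j-1}b_i+h\prod_{i=1}^{2h}b_i,$$ $$S=\frac{(q_A-q_B)^2\left(1+(-1)^{r+s}q_A^rq_B^s\right)}{(r+s)(1+q_A)^2(1+q_B)^2\left(1-(q_A^rq_B^s)^2\right)}.$$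
   Context: **Pattern strategies.** A nonrandom periodic pattern strategy $D$ is a finite word $D=D_1D_2\cdots D_n$ in the letters $A,B$ containing $r\ge1$ letters $A$ and $s\ge1$ letters $B$, $n=r+s$; the player pulls the arms in the order of the word and repeats the word indefinitely. $A^k$ (resp. $B^k$) denotes $k$ consecutive letters $A$ (resp. $B$). Put $p_i=p_A$, $q_i=q_A$ if $D_i=A$ and $p_i=p_B$, $q_i=q_B$ if $D_i=B$, extended $n$-periodically in $i$. **Two-armed Futurity machine with $J=2$.** At each coup arm $A$ (resp. $B$) wins a non-Futurity payout with probability $p_A$ (resp. $p_B$), independently of the past, and otherwise loses. A pointer records the current number ($0$ or $1$) of consecutive losses; whenever it would reach $J=2$, the Futurity award of $2$ coins is paid and the pointer resets to $0$; a win resets it to $0$. Under $D$ this is the Markov chain on $\{0,\dots,2n-1\}\times\{0,1\}$ with transitions $(i,0)\to(i+1\bmod 2n,0)$ with probability $p_{i+1}$, $(i,0)\to(i+1\bmod 2n,1)$ with probability $q_{i+1}$, and $(i,1)\to(i+1\bmod 2n,0)$ with probability $1$. With $\pi$ its unique stationary distribution, the asymptotic probability per coup of winning the Futurity award is $p_D^\circ=\sum_{i=0}^{2n-1}\pi(i,1)q_{i+1}$. It is a known result of Ethier and Lee that $$p_D^\circ=\frac1{r+s}\sum_{k=1}^{r+s}\Big(\sum_{j=1}^{r+s}p_j\prod_{i=j+1}^{j+2k}q_i\Big)\frac1{1-(q_A^rq_B^s)^2}.$$ If only arm $A$ (resp. only arm $B$) is played, the corresponding probability is $p_A^\circ=\frac{p_Aq_A^2}{1-q_A^2}$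 (resp. $p_B^\circ=\frac{p_Bq_B^2}{1-q_B^2}$). **Profit.** Let $u_A$ (resp. $u_B$) be the conditional mean non-Futurity payout of arm $A$ (resp. $B$) given a win. The asymptotic mean payouts per coup, including the Futurity award, are $\mu_A^*=p_Au_A+2p_A^\circ$, $\mu_B^*=p_Bu_B+2p_B^\circ$ when a single arm is played, and $\mu_D^*=\frac{r}{r+s}p_Au_A+\frac{s}{r+s}p_Bu_B+2p_D^\circ$ under $D$. The casino's asymptotic profit per coup attributable to the two-armed feature of the machine is $$R_D=\frac{r}{r+s}\mu_A^*+\frac{s}{r+s}\mu_B^*-\mu_D^*=2\Big(\frac{r}{r+s}p_A^\circ+\frac{s}{r+s}p_B^\circ-p_D^\circ\Big).$$ *)

theory Defs
  imports "HOL-Probability.Probability"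
begin

datatype arm = ArmA | ArmB

text \<open>
  Throughout, \<open>p a\<close> is the probability that arm \<open>a\<close> wins a non-Futurity payout, and \<open>u a\<close> is the
  conditional mean of that payout given a win. A strategy is a nonempty word \<open>D\<close>, repeated
  indefinitely. The letters are indexed from 0, so \<open>D ! (i mod length D)\<close> is the arm pulled at the
  coup that leaves position \<open>i\<close>, written $D_{i+1}$ with letters indexed from 1.
\<close>

definition played_arm :: "arm list \<Rightarrow> nat \<Rightarrow> arm" where
  "played_arm D i = D ! (i mod length D)"

definition futurity_states :: "arm list \<Rightarrow> (nat \<times> nat) set" where
  "futurity_states D = {0..<2 * length D} \<times> {0, 1}"

text \<open>
  A state is a position together with the pointer (the current number of consecutive losses).
  From pointer 1 the next pointer is 0 whatever happens: a win resets it, and a loss pays the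
  award and resets it.
\<close>

definition futurity_step :: "(arm \<Rightarrow> real) \<Rightarrow> arm list \<Rightarrow> nat \<times> nat \<Rightarrow> (nat \<times> nat) pmf" where
  "futurity_step p D = (\<lambda>(i, c).
     let i' = (i + 1) mod (2 * length D) in
     if c = 0 then map_pmf (\<lambda>win. (i', if win then 0 else 1)) (bernoulli_pmf (p (played_arm D i)))
     else return_pmf (i', 0))"

definition futurity_stationary :: "(arm \<Rightarrow> real) \<Rightarrow> arm list \<Rightarrow> (nat \<times> nat) pmf \<Rightarrow> bool" where
  "futurity_stationary p D \<pi> \<longleftrightarrow>
     set_pmf \<pi> \<subseteq> futurity_states D \<and> bind_pmf \<pi> (futurity_step p D) = \<pi>"

text \<open>
  For \<open>0 < p a < 1\<close> and \<open>D \<noteq> []\<close> the chain is irreducible on its finite state space, so the definite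
  description below denotes its unique stationary distribution.
\<close>

definition futurity_prob :: "(arm \<Rightarrow> real) \<Rightarrow> arm list \<Rightarrow> real" where
  "futurity_prob p D =
     (let \<pi> = (THE \<pi>. futurity_stationary p D \<pi>) in
      \<Sum>i = 0..<2 * length D. pmf \<pi> (i, 1) * (1 - p (played_arm D i)))"

text \<open>
  Playing a single arm \<open>a\<close> is the strategy \<open>[a]\<close>; with \<open>q = 1 - p a\<close> its stationary distribution
  gives \<open>futurity_prob p [a] = p a * q\<^sup>2 / (1 - q\<^sup>2)\<close>, and \<open>mean_payout\<close> becomes
  \<open>p a * u a + 2 * futurity_prob p [a]\<close>. The factor 2 is the award of 2 coins.
\<close>

definition mean_payout :: "(arm \<Rightarrow> real) \<Rightarrow> (arm \<Rightarrow> real) \<Rightarrow> arm list \<Rightarrow> real" where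
  "mean_payout p u D =
     real (count_list D ArmA) / real (length D) * (p ArmA * u ArmA)
     + real (count_list D ArmB) / real (length D) * (p ArmB * u ArmB)
     + 2 * futurity_prob p D"

definition casino_profit :: "(arm \<Rightarrow> real) \<Rightarrow> (arm \<Rightarrow> real) \<Rightarrow> arm list \<Rightarrow> real" where
  "casino_profit p u D =
     real (count_list D ArmA) / real (length D) * mean_payout p u [ArmA]
     + real (count_list D ArmB) / real (length D) * mean_payout p u [ArmB]
     - mean_payout p u D"

definition block_pattern :: "nat \<Rightarrow> (nat \<Rightarrow> nat) \<Rightarrow> (nat \<Rightarrow> nat) \<Rightarrow> arm list" where
  "block_pattern h rs ss =
     concat (map (\<lambda>k. replicate (rs k) ArmA @ replicate (ss k) ArmB) [1..<h + 1])"

end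

theory Submission
  imports Defs
begin

text \<open>
  A stationary distribution has uniform position marginal, and the conditional probability
  \<open>y\<^sub>i\<close> that the pointer is 1 at position \<open>i\<close> satisfies \<open>y\<^sub>i\<^sub>+\<^sub>1 = q\<^sub>i\<^sub>+\<^sub>1 (1 - y\<^sub>i)\<close>, a contraction over one
  period. Hence the award probability is the average of \<open>q\<^sub>i - y\<^sub>i\<close>. Within a block of arm \<open>a\<close> the
  deviation of \<open>y\<close> from the single-arm value \<open>q\<^sub>a / (1 + q\<^sub>a)\<close> is geometric with ratio \<open>- q\<^sub>a\<close>, so
  the sum of deviations over a block depends only on its two ends, and the profit reduces to the
  sum of the block-end deviations. With alternating signs these satisfy \<open>e\<^sub>m = b\<^sub>m (\<delta> - e\<^sub>m\<^sub>-\<^sub>1)\<close> cyclically, with \<open>\<delta>\<close> the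
  difference of the two single-arm values; unrolling once around the cycle yields \<open>Q\<close>.
\<close>

section \<open>The pointer along a finite word\<close>

text \<open>If the pointer is 1 with probability \<open>y\<close> before the word \<open>xs\<close>,
  this is the probability that it is 1 afterwards, for loss probabilities \<open>q\<close>: reaching
  1 takes pointer 0 and then a loss.\<close>

definition pointer_prob :: "('a \<Rightarrow> real) \<Rightarrow> 'a list \<Rightarrow> real \<Rightarrow> real" where
  "pointer_prob q xs y = fold (\<lambda>a y. q a * (1 - y)) xs y"

text \<open>Accumulates the pointer probabilities after each letter: the initial \<open>y\<close> is
  left out, the final value is included.\<close>

fun pointer_sum :: "('a \<Rightarrow> real) \<Rightarrow> 'a list \<Rightarrow> real \<Rightarrow> real" where
  "pointer_sum q [] y = 0"
| "pointer_sum q (a # xs) y = q a * (1 - y) + pointer_sum q xs (q a * (1 - y))"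

lemma pointer_prob_simps [simp]:
  "pointer_prob q [] y = y"
  "pointer_prob q (a # xs) y = pointer_prob q xs (q a * (1 - y))"
  "pointer_prob q (xs @ ys) y = pointer_prob q ys (pointer_prob q xs y)"
  by (simp_all add: pointer_prob_def)

lemma pointer_sum_append [simp]:
  "pointer_sum q (xs @ ys) y = pointer_sum q xs y + pointer_sum q ys (pointer_prob q xs y)"
  by (induction xs arbitrary: y) auto

lemma pointer_prob_bounds:
  assumes "\<And>a. 0 \<le> q a" "\<And>a. q a \<le> 1" "0 \<le> y" "y \<le> 1"
  shows "0 \<le> pointer_prob q xs y \<and> pointer_prob q xs y \<le> 1"
  using assms(3,4)
proof (induction xs arbitrary: y)
  case (Cons a xs)
  have "0 \<le> q a * (1 - y)" "q a * (1 - y) \<le> 1"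
    using Cons.prems assms(1,2) by (auto intro!: mult_le_one)
  then show ?case using Cons.IH by simp
qed simp

lemma continuous_on_pointer_prob: "continuous_on S (pointer_prob q xs)"
proof (induction xs arbitrary: S)
  case (Cons a xs)
  have "continuous_on S (\<lambda>y. pointer_prob q xs (q a * (1 - y)))"
    by (rule continuous_on_compose2[OF Cons.IH[of UNIV]]) (auto intro!: continuous_intros)
  then show ?case by simp
next
  case Nil
  show ?case by simp
qed

text \<open>The word maps the unit interval into itself, so the intermediate value theorem applies
  to \<open>pointer_prob q xs y - y\<close>.\<close>

lemma pointer_prob_fixed_point:
  assumes "\<And>a. 0 \<le> q a" "\<And>a. q a \<le> 1"
  obtains y where "0 \<le> y" "y \<le> 1" "pointer_prob q xs y = y"
proof -
  have "\<exists>y\<ge>0. y \<le> 1 \<and> pointer_prob q xs y - y = 0"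
    using pointer_prob_bounds[of q 0 xs, OF assms] pointer_prob_bounds[of q 1 xs, OF assms]
    by (intro IVT2') (auto intro!: continuous_intros continuous_on_pointer_prob)
  then show ?thesis using that by force
qed

text \<open>One letter acts as an affine map with slope \<open>- q a\<close> and fixed point
  \<open>q a / (1 + q a)\<close>.\<close>

lemma pointer_prob_replicate:
  assumes "q a \<noteq> -1"
  shows "pointer_prob q (replicate k a) y
    = q a / (1 + q a) + (- q a) ^ k * (y - q a / (1 + q a))"
proof (induction k arbitrary: y)
  case (Suc k)
  have "1 + q a \<noteq> 0" using assms by linarith
  then have "q a * (1 - y) - q a / (1 + q a) = - q a * (y - q a / (1 + q a))"
    by (simp add: field_simps)
  then show ?case using Suc by simp
qed simp

text \<open>One step \<open>z = q a * (1 - y)\<close> can be rewritten as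
  \<open>z = q a / (1 + q a) * (1 - y + z)\<close>; summed over the block, the differences
  \<open>z - y\<close> telescope.\<close>

lemma pointer_sum_replicate:
  assumes "q a \<noteq> -1"
  shows "pointer_sum q (replicate k a) y
    = q a / (1 + q a) * (real k - y + pointer_prob q (replicate k a) y)"
proof (induction k arbitrary: y)
  case (Suc k)
  define z where "z = q a * (1 - y)"
  have "1 + q a \<noteq> 0" using assms by linarith
  then have z: "z = q a / (1 + q a) * (1 - y + z)"
    unfolding z_def by (simp add: field_simps)
  have "pointer_sum q (replicate (Suc k) a) y
    = q a / (1 + q a) * (1 - y + z)
      + q a / (1 + q a) * (real k - z + pointer_prob q (replicate k a) z)"
    using Suc[of z] z by (simp add: z_def)
  also have "\<dots> = q a / (1 + q a) * (real (Suc k) - y + pointer_prob q (replicate k a) z)"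
    by (simp add: distrib_left[symmetric] del: times_divide_eq_left)
  finally show ?case by (simp add: z_def)
qed simp

text \<open>The same recurrence indexed by time, so that it can run past the end of the word and be
  compared with the chain, whose positions cover two periods.\<close>

primrec pointer_orbit :: "(nat \<Rightarrow> real) \<Rightarrow> real \<Rightarrow> nat \<Rightarrow> real" where
  "pointer_orbit f y 0 = y"
| "pointer_orbit f y (Suc i) = f i * (1 - pointer_orbit f y i)"

lemma pointer_orbit_take:
  assumes "\<And>i. i < length D \<Longrightarrow> f i = q (D ! i)" "k \<le> length D"
  shows "pointer_orbit f y k = pointer_prob q (take k D) y \<and>
    (\<Sum>i<k. pointer_orbit f y (Suc i)) = pointer_sum q (take k D) y"
  using assms(2) by (induction k) (auto simp: take_Suc_conv_app_nth assms(1))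

lemma pointer_orbit_periodic:
  assumes "\<And>i. f (i + n) = f i" "pointer_orbit f y n = y"
  shows "pointer_orbit f y (i + n) = pointer_orbit f y i"
  using assms by (induction i) auto

text \<open>The absolute values never increase, and the first step shrinks by the factor
  \<open>c 0 < 1\<close>; returning to \<open>d 0\<close> after \<open>N\<close> steps therefore
  forces \<open>d 0 = 0\<close>.\<close>

lemma periodic_decay_zero:
  fixes d c :: "nat \<Rightarrow> real"
  assumes "\<And>i. d (Suc i) = - c i * d i" "\<And>i. 0 \<le> c i" "\<And>i. c i < 1"
    and "d N = d 0" "0 < N"
  shows "d i = 0"
proof -
  have dec: "\<bar>d (Suc i)\<bar> \<le> \<bar>d i\<bar>" for i
    using assms(2)[of i] assms(3)[of i] by (simp add: assms(1) abs_mult mult_left_le_one_le)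
  have "\<bar>d N\<bar> \<le> \<bar>d 1\<bar>" using lift_Suc_antimono_le[of "\<lambda>i. \<bar>d i\<bar>" 1 N] dec assms(5) by simp
  then have "\<bar>d 0\<bar> \<le> c 0 * \<bar>d 0\<bar>"
    using assms(1)[of 0] assms(2)[of 0] assms(4) by (simp add: abs_mult)
  then have "d 0 = 0"
    using assms(3)[of 0] by (metis abs_ge_zero abs_0_eq less_eq_real_def mult_less_cancel_right2 not_le order.strict_iff_not)
  then show ?thesis by (induction i) (auto simp: assms(1))
qed

section \<open>The stationary distribution\<close>

lemma pmf_map_bernoulli:
  assumes "0 \<le> r" "r \<le> 1" "x \<noteq> y"
  shows "pmf (map_pmf (\<lambda>w. (a, if w then x else y)) (bernoulli_pmf r)) (b, d)
    = (if a = b then if d = x then r else if d = y then 1 - r else 0 else 0)"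
proof -
  have "pmf (map_pmf (\<lambda>w. (a, if w then x else y)) (bernoulli_pmf r)) (b, d)
    = (\<Sum>w\<in>UNIV. of_bool ((a, if w then x else y) = (b, d)) * pmf (bernoulli_pmf r) w)"
    unfolding map_pmf_def pmf_bind
    by (subst integral_measure_pmf_real[of UNIV]) (auto simp: UNIV_bool indicator_def)
  then show ?thesis using assms by (auto simp: UNIV_bool)
qed

text \<open>Only states at position \<open>i\<close> lead to the next position, so the sum over all
  states collapses to the two pointer values there.\<close>

lemma pmf_bind_futurity_step:
  assumes "set_pmf \<pi> \<subseteq> futurity_states D" "i < 2 * length D"
    and "\<And>a. 0 \<le> p a" "\<And>a. p a \<le> 1"
  shows "pmf (bind_pmf \<pi> (futurity_step p D)) (Suc i mod (2 * length D), 1)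
      = (1 - p (played_arm D i)) * pmf \<pi> (i, 0)" (is ?A)
    and "pmf (bind_pmf \<pi> (futurity_step p D)) (Suc i mod (2 * length D), 0)
      = p (played_arm D i) * pmf \<pi> (i, 0) + pmf \<pi> (i, 1)" (is ?B)
proof -
  let ?N = "2 * length D"
  have inj: "Suc j mod ?N = Suc i mod ?N \<longleftrightarrow> j = i" if "j < ?N" for j
    using that assms(2) by (auto simp: mod_Suc split: if_splits)
  have val: "pmf (futurity_step p D (j, c)) (Suc i mod ?N, d) =
     (if j = i then if c = 0 then (if d = 1 then 1 - p (played_arm D i) else if d = 0 then p (played_arm D i) else 0)
        else if d = 0 then 1 else 0 else 0)" if "j < ?N" for j c d
    using assms(3,4) inj[OF that]
    by (auto simp: futurity_step_def pmf_map_bernoulli Let_def indicator_def)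
  have bind: "pmf (bind_pmf \<pi> (futurity_step p D)) (Suc i mod ?N, d) =
    (\<Sum>j<?N. (\<Sum>c\<in>{0,1}. pmf (futurity_step p D (j, c)) (Suc i mod ?N, d) * pmf \<pi> (j, c)))" for d
  proof -
    have "pmf (bind_pmf \<pi> (futurity_step p D)) (Suc i mod ?N, d) =
      (\<Sum>x\<in>futurity_states D. pmf (futurity_step p D x) (Suc i mod ?N, d) * pmf \<pi> x)"
      unfolding pmf_bind
      by (rule integral_measure_pmf_real) (use assms(1) in \<open>auto simp: futurity_states_def\<close>)
    then show ?thesis
      by (simp only: futurity_states_def sum.cartesian_product' atLeast0LessThan)
  qed
  have pick: "(\<Sum>j<?N. if j = i then x j else 0) = x i" for x :: "nat \<Rightarrow> real"
    using assms(2) by simp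
  have "pmf (bind_pmf \<pi> (futurity_step p D)) (Suc i mod ?N, 1) =
     (\<Sum>j<?N. if j = i then (1 - p (played_arm D i)) * pmf \<pi> (j, 0) else 0)"
    unfolding bind by (rule sum.cong) (auto simp: val)
  then show ?A unfolding pick .
  have "pmf (bind_pmf \<pi> (futurity_step p D)) (Suc i mod ?N, 0) =
     (\<Sum>j<?N. if j = i then p (played_arm D i) * pmf \<pi> (j, 0) + pmf \<pi> (j, 1) else 0)"
    unfolding bind by (rule sum.cong) (auto simp: val)
  then show ?B unfolding pick .
qed

text \<open>Stationarity makes the mass \<open>w\<close> of a position constant, hence
  \<open>1 / N\<close>. The difference \<open>d\<close> between the mass at pointer 1 and
  \<open>Y j / N\<close> then satisfies a homogeneous contracting periodic recurrence and
  vanishes.\<close>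

lemma futurity_stationary_unique:
  assumes "D \<noteq> []" "\<And>a. 0 < p a" "\<And>a. p a < 1"
    and Y: "\<And>i. Y (Suc i) = (1 - p (played_arm D i)) * (1 - Y i)"
    and per: "Y (2 * length D) = Y 0"
    and st: "futurity_stationary p D \<pi>" and "i < 2 * length D"
  shows "pmf \<pi> (i, 0) = (1 - Y i) / (2 * length D)" "pmf \<pi> (i, 1) = Y i / (2 * length D)"
proof -
  define N where "N = 2 * length D"
  have N: "0 < N" using assms(1) by (simp add: N_def)
  have sub: "set_pmf \<pi> \<subseteq> futurity_states D" and inv: "bind_pmf \<pi> (futurity_step p D) = \<pi>"
    using st by (auto simp: futurity_stationary_def)
  note p01 = less_imp_le[OF assms(2)] less_imp_le[OF assms(3)]
  note step = pmf_bind_futurity_step[of \<pi> D _ p, OF sub _ p01, unfolded inv, folded N_def]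
  \<comment> \<open>Reducing the index modulo \<open>N\<close> lets plain induction over the
    naturals pass the wraparound.\<close>
  define w where "w j = pmf \<pi> (j mod N, 0) + pmf \<pi> (j mod N, 1)" for j
  have "w (Suc j) = w j" for j
    using step[of "j mod N"] N by (simp add: w_def mod_Suc_eq algebra_simps played_arm_def N_def mod_mod_cancel)
  then have wc: "w j = w 0" for j by (induction j) auto
  have "1 = (\<Sum>x\<in>futurity_states D. pmf \<pi> x)"
    using sub by (subst sum_pmf_eq_1) (auto simp: futurity_states_def)
  also have "\<dots> = (\<Sum>j<N. w j)"
    unfolding futurity_states_def sum.cartesian_product' by (simp add: w_def N_def atLeast0LessThan)
  also have "\<dots> = (\<Sum>j<N. w 0)" by (rule sum.cong) (use wc in auto)
  also have "\<dots> = N * w 0" by simp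
  finally have w: "w j = 1 / N" for j using wc[of j] N by (simp add: field_simps)
  define d where "d j = pmf \<pi> (j mod N, 1) - Y j / N" for j
  have "d (Suc j) = - (1 - p (played_arm D j)) * d j" for j
  proof -
    have "played_arm D (j mod N) = played_arm D j"
      by (simp add: played_arm_def N_def mod_mod_cancel)
    then have "pmf \<pi> (Suc j mod N, 1) = (1 - p (played_arm D j)) * (w j - pmf \<pi> (j mod N, 1))"
      using step(1)[of "j mod N"] N by (simp add: w_def mod_Suc_eq)
    then show ?thesis using N by (simp add: d_def w Y field_simps)
  qed
  moreover have "d N = d 0" using per by (simp add: d_def N_def)
  ultimately have "d i = 0"
    using assms(2,3) N by (intro periodic_decay_zero[of d "\<lambda>j. 1 - p (played_arm D j)" N])
      (auto simp: less_imp_le)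
  then have 1: "pmf \<pi> (i, 1) = Y i / N" using assms(7) by (simp add: d_def N_def)
  show "pmf \<pi> (i, 1) = Y i / (2 * length D)" using 1 by (simp add: N_def)
  show "pmf \<pi> (i, 0) = (1 - Y i) / (2 * length D)"
    using 1 w[of i] assms(7) by (simp add: w_def N_def diff_divide_distrib)
qed

text \<open>The witness draws the position uniformly and then the pointer with success probability
  \<open>Y i\<close>.\<close>

lemma futurity_stationary_exists:
  assumes "D \<noteq> []" "\<And>a. 0 \<le> p a" "\<And>a. p a \<le> 1"
    and Y: "\<And>i. Y (Suc i) = (1 - p (played_arm D i)) * (1 - Y i)"
    and per: "Y (2 * length D) = Y 0"
    and Y01: "\<And>i. 0 \<le> Y i" "\<And>i. Y i \<le> 1"
  shows "\<exists>\<pi>. futurity_stationary p D \<pi>"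
proof -
  define N where "N = 2 * length D"
  have N: "0 < N" "{..<N} \<noteq> {}" using assms(1) by (auto simp: N_def lessThan_empty_iff)
  define \<pi> where "\<pi> = bind_pmf (pmf_of_set {..<N})
    (\<lambda>i. map_pmf (\<lambda>c. (i, if c then 1 else 0::nat)) (bernoulli_pmf (Y i)))"
  have sub: "set_pmf \<pi> \<subseteq> futurity_states D"
    using N by (auto simp: \<pi>_def futurity_states_def set_bind_pmf N_def split: if_splits)
  have pmf_\<pi>: "pmf \<pi> (i, d) = (if d = 1 then Y i else if d = 0 then 1 - Y i else 0) / N"
    if "i < N" for i d
    using that N Y01
    by (simp add: \<pi>_def pmf_bind integral_pmf_of_set pmf_map_bernoulli)
  note step = pmf_bind_futurity_step[of \<pi> D _ p, OF sub _ assms(2,3), folded N_def]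
  have supp: "set_pmf (bind_pmf \<pi> (futurity_step p D)) \<subseteq> futurity_states D"
    using N by (auto simp: futurity_states_def futurity_step_def Let_def N_def split: if_splits)
  have "pmf (bind_pmf \<pi> (futurity_step p D)) x = pmf \<pi> x" for x
  proof (cases "x \<in> futurity_states D")
    case True
    obtain j c where x: "x = (j, c)" by force
    have j: "j < N" "c = 0 \<or> c = 1" using True x by (auto simp: futurity_states_def N_def)
    \<comment> \<open>The cyclic predecessor of \<open>j\<close>; for \<open>j = 0\<close> it gives
      \<open>Suc i = N\<close>, and periodicity of \<open>Y\<close> is what yields
      \<open>Y (Suc i) = Y j\<close>.\<close>
    define i where "i = (if j = 0 then N - 1 else j - 1)"
    have i: "i < N" "Suc i mod N = j" "Y (Suc i) = Y j"
      using j(1) N per by (auto simp: i_def N_def)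
    have "Y j = (1 - p (played_arm D i)) * (1 - Y i)" using Y i(3) by simp
    then show ?thesis
      using step[OF i(1)] i(1,2) j by (auto simp: x pmf_\<pi> field_simps)
  next
    case False
    then show ?thesis using sub supp by (metis pmf_eq_0_set_pmf subsetD)
  qed
  then have "futurity_stationary p D \<pi>"
    using sub by (auto simp: futurity_stationary_def intro: pmf_eqI)
  then show ?thesis ..
qed

lemma sum_lessThan_add:
  fixes g :: "nat \<Rightarrow> 'a::comm_monoid_add"
  shows "(\<Sum>i<m + n. g i) = (\<Sum>i<m. g i) + (\<Sum>i<n. g (i + m))"
  by (induction n) (simp_all add: add_ac)

text \<open>The recurrence turns the award weight \<open>f i * Y i\<close> into
  \<open>f i - Y (Suc i)\<close>, and summing over one period gives the two sums.\<close>

lemma futurity_prob_eq: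
  assumes "D \<noteq> []" "\<And>a. 0 < p a" "\<And>a. p a < 1" "0 \<le> y" "y \<le> 1"
    and fixed: "pointer_prob (\<lambda>a. 1 - p a) D y = y"
  shows "futurity_prob p D
    = ((\<Sum>a\<leftarrow>D. 1 - p a) - pointer_sum (\<lambda>a. 1 - p a) D y) / length D"
proof -
  let ?n = "length D" and ?q = "\<lambda>a. 1 - p a"
  define f where "f i = 1 - p (played_arm D i)" for i
  define Y where "Y = pointer_orbit f y"
  have take: "Y k = pointer_prob ?q (take k D) y \<and> (\<Sum>i<k. Y (Suc i)) = pointer_sum ?q (take k D) y"
    if "k \<le> ?n" for k
    unfolding Y_def using that by (intro pointer_orbit_take) (auto simp: f_def played_arm_def)
  have "Y ?n = y" using take[of ?n] fixed by simp
  then have per: "Y (i + ?n) = Y i" for i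
    unfolding Y_def by (intro pointer_orbit_periodic) (auto simp: f_def played_arm_def)
  have per2: "Y (2 * ?n) = Y 0" using per[of 0] per[of ?n] by (simp add: mult_2)
  have Suc: "Y (Suc i) = (1 - p (played_arm D i)) * (1 - Y i)" for i by (simp add: Y_def f_def)
  have Y01: "0 \<le> Y i \<and> Y i \<le> 1" for i
  proof (induction i)
    case (Suc i)
    then show ?case using assms(2,3)[of "played_arm D i"] by (auto simp: \<open>Y (Suc i) = _\<close> intro!: mult_le_one)
  qed (use assms in \<open>auto simp: Y_def\<close>)
  obtain \<pi>0 where \<pi>0: "futurity_stationary p D \<pi>0"
    using futurity_stationary_exists[of D p Y] assms(1-3) Suc per2 Y01 by (auto simp: less_imp_le)
  note unique = futurity_stationary_unique[of D p Y, OF assms(1-3) Suc per2]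
  have "\<pi> = \<pi>0" if "futurity_stationary p D \<pi>" for \<pi>
  proof (rule pmf_eqI)
    fix x
    show "pmf \<pi> x = pmf \<pi>0 x"
    proof (cases "x \<in> futurity_states D")
      case True
      then show ?thesis
        using unique[OF that] unique[OF \<pi>0] by (auto simp: futurity_states_def)
    next
      case False
      then show ?thesis
        using that \<pi>0 unfolding futurity_stationary_def by (metis pmf_eq_0_set_pmf subsetD)
    qed
  qed
  \<comment> \<open>Existence and uniqueness together resolve the definite description in
    \<open>futurity_prob\<close>.\<close>
  then have the: "(THE \<pi>. futurity_stationary p D \<pi>) = \<pi>0" using \<pi>0 by blast
  have "futurity_prob p D = (\<Sum>i<2 * ?n. Y i / (2 * ?n) * f i)"
    using unique(2)[OF \<pi>0] by (simp add: futurity_prob_def the f_def atLeast0LessThan)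
  also have "\<dots> = (\<Sum>i<?n + ?n. f i * Y i) / (2 * ?n)"
    unfolding mult_2[of ?n] sum_divide_distrib by (simp add: mult.commute)
  also have "(\<Sum>i<?n + ?n. f i * Y i) = (\<Sum>i<?n. f i * Y i) + (\<Sum>i<?n. f (i + ?n) * Y (i + ?n))"
    by (rule sum_lessThan_add)
  \<comment> \<open>The chain runs through the word twice, and both passes contribute equally
    because \<open>Y\<close> already has period \<open>length D\<close>.\<close>
  also have "\<dots> = 2 * (\<Sum>i<?n. f i * Y i)"
    unfolding per by (simp add: f_def played_arm_def)
  also have "(\<Sum>i<?n. f i * Y i) = (\<Sum>i<?n. f i) - (\<Sum>i<?n. Y (Suc i))"
    by (simp add: Suc f_def sum_subtractf[symmetric] algebra_simps)
  also have "(\<Sum>i<?n. Y (Suc i)) = pointer_sum ?q D y" using take[of ?n] by simp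
  also have "(\<Sum>i<?n. f i) = (\<Sum>a\<leftarrow>D. 1 - p a)"
    by (simp add: f_def played_arm_def sum_list_sum_nth atLeast0LessThan)
  finally show ?thesis by (simp del: right_diff_distrib_numeral)
qed

text \<open>Equal to \<open>p a * q^2 / (1 - q^2)\<close>, but split so that the loss probability
  \<open>q\<close> can cancel in the profit, leaving the stationary pointer value.\<close>

lemma futurity_prob_single:
  assumes "\<And>a. 0 < p a" "\<And>a. p a < 1" "q = 1 - p a"
  shows "futurity_prob p [a] = q - q / (1 + q)"
proof -
  have q: "0 < q" using assms(2)[of a] assms(3) by simp
  have fixed: "(1 - p a) * (1 - q / (1 + q)) = q / (1 + q)"
    using q by (simp add: assms(3)[symmetric] field_simps)
  have "futurity_prob p [a]
    = ((\<Sum>a\<leftarrow>[a]. 1 - p a) - pointer_sum (\<lambda>a. 1 - p a) [a] (q / (1 + q))) / length [a]"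
    by (rule futurity_prob_eq) (use assms(1,2) q fixed in auto)
  also have "\<dots> = q - q / (1 + q)" using fixed assms(3) by simp
  finally show ?thesis .
qed

section \<open>Affine recurrences over a cycle\<close>

lemma sum_shift_periodic:
  fixes f :: "nat \<Rightarrow> 'a::comm_monoid_add"
  assumes "f N = f 0"
  shows "(\<Sum>i<N. f (Suc i)) = (\<Sum>i<N. f i)"
proof (cases N)
  case (Suc k)
  have "(\<Sum>i<Suc k. f i) = f 0 + (\<Sum>i<k. f (Suc i))" by (rule sum.lessThan_Suc_shift)
  then show ?thesis using assms Suc by (simp add: add.commute)
qed simp

lemma prod_shift_periodic:
  fixes f :: "nat \<Rightarrow> 'a::comm_monoid_mult"
  assumes "f N = f 0"
  shows "(\<Prod>i<N. f (Suc i)) = (\<Prod>i<N. f i)"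
proof (cases N)
  case (Suc k)
  have "(\<Prod>i<Suc k. f i) = f 0 * (\<Prod>i<k. f (Suc i))" by (rule prod.lessThan_Suc_shift)
  then show ?thesis using assms Suc by (simp add: mult.commute)
qed simp

lemma prod_window_periodic:
  fixes b :: "nat \<Rightarrow> 'a::comm_monoid_mult"
  assumes "\<And>i. b (i + N) = b i"
  shows "(\<Prod>i<N. b (m + i)) = (\<Prod>i<N. b i)"
proof (induction m)
  case (Suc m)
  then show ?case using prod_shift_periodic[of "\<lambda>i. b (m + i)" N] assms[of m] by simp
qed simp

text \<open>Summing the recurrence against a window of \<open>j\<close> following coefficients and shifting the window
  by one turns it into the window of length \<open>j + 1\<close>; after a full cycle the window is constant.\<close>

lemma cyclic_affine_recurrence_sum:
  fixes b e :: "nat \<Rightarrow> real"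
  assumes "\<And>i. b (i + N) = b i" "\<And>i. i < N \<Longrightarrow> e (Suc i) = b (Suc i) * (\<delta> - e i)" "e N = e 0"
  shows "(\<Sum>m<N. e (Suc m)) * (1 - (-1) ^ N * (\<Prod>i<N. b i))
    = - \<delta> * (\<Sum>j=1..N. (-1) ^ j * (\<Sum>m<N. \<Prod>i<j. b (Suc m + i)))"
proof -
  define P where "P m j = (\<Prod>i<j. b (m + i))" for m j
  have P_Suc: "P m (Suc j) = b m * P (Suc m) j" for m j
    using prod.lessThan_Suc_shift[of "\<lambda>i. b (m + i)" j] by (simp add: P_def del: prod.lessThan_Suc)
  have P_per: "P (m + N) j = P m j" for m j
    using assms(1)[of "m + _"] by (simp add: P_def add.assoc add.left_commute add.commute)
  \<comment> \<open>The window starts just after \<open>Suc m\<close>, so that expanding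
    \<open>e (Suc m)\<close> by the recurrence prepends \<open>b (Suc m)\<close> and yields the
    window of length \<open>Suc j\<close> from \<open>Suc m\<close>.\<close>
  define U where "U j = (\<Sum>m<N. P (Suc (Suc m)) j * e (Suc m))" for j
  have U_rec: "U j = \<delta> * (\<Sum>m<N. P (Suc m) (Suc j)) - U (Suc j)" for j
  proof -
    have "U (Suc j) = (\<Sum>m<N. P (Suc m) (Suc j) * e m)"
      unfolding U_def
      using sum_shift_periodic[of "\<lambda>m. P (Suc m) (Suc j) * e m" N] assms(3) P_per[of 1]
      by (simp add: add.commute)
    moreover have "U j = (\<Sum>m<N. \<delta> * P (Suc m) (Suc j) - P (Suc m) (Suc j) * e m)"
      unfolding U_def by (rule sum.cong) (simp_all add: assms(2) P_Suc algebra_simps)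
    ultimately show ?thesis by (simp add: sum_subtractf sum_distrib_left)
  qed
  have unroll: "U 0 = (-1) ^ j * U j - \<delta> * (\<Sum>l=1..j. (-1) ^ l * (\<Sum>m<N. P (Suc m) l))" for j
  proof (induction j)
    case (Suc j)
    then show ?case by (simp add: U_rec[of j] algebra_simps)
  qed simp
  have P_const: "P m N = P 0 N" for m
    using prod_window_periodic[of b N, OF assms(1)] by (simp add: P_def)
  have "U N = P 0 N * (\<Sum>m<N. e (Suc m))"
    unfolding U_def P_const[of "Suc (Suc _)"] by (simp add: sum_distrib_left)
  moreover have "U 0 = (\<Sum>m<N. e (Suc m))" by (simp add: U_def P_def)
  ultimately have "(\<Sum>m<N. e (Suc m)) * (1 - (-1) ^ N * P 0 N)
    = - \<delta> * (\<Sum>l=1..N. (-1) ^ l * (\<Sum>m<N. P (Suc m) l))"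
    using unroll[of N] by (simp add: algebra_simps)
  then show ?thesis by (simp add: P_def)
qed

section \<open>Block patterns\<close>

lemma block_pattern_simps [simp]:
  "block_pattern 0 rs ss = []"
  "block_pattern (Suc h) rs ss
    = block_pattern h rs ss @ replicate (rs (Suc h)) ArmA @ replicate (ss (Suc h)) ArmB"
  by (simp_all add: block_pattern_def)

lemma count_list_replicate: "count_list (replicate k a) x = (if a = x then k else 0)"
  by (induction k) auto

lemma count_list_block_pattern:
  "count_list (block_pattern h rs ss) ArmA = (\<Sum>k=1..h. rs k)"
  "count_list (block_pattern h rs ss) ArmB = (\<Sum>k=1..h. ss k)"
  by (induction h) (auto simp: count_list_replicate)

lemma length_block_pattern:
  "length (block_pattern h rs ss) = (\<Sum>k=1..h. rs k) + (\<Sum>k=1..h. ss k)"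
  by (induction h) auto

lemma sum_list_block_pattern:
  "(\<Sum>a\<leftarrow>block_pattern h rs ss. f a)
    = real (\<Sum>k=1..h. rs k) * f ArmA + real (\<Sum>k=1..h. ss k) * f ArmB"
  by (induction h) (auto simp: sum_list_replicate algebra_simps)

text \<open>Here \<open>\<alpha>\<close> and \<open>\<beta>\<close> are the stationary pointer probabilities of the single arms, and \<open>e\<close> is the
  deviation from them at the ends of the blocks, taken with alternating sign so that both kinds of
  block satisfy the same recurrence.\<close>

lemma pointer_block_pattern:
  fixes \<alpha> \<beta> :: real and e :: "nat \<Rightarrow> real"
  assumes "q ArmA \<noteq> -1" "q ArmB \<noteq> -1"
    and \<alpha>: "\<alpha> = q ArmA / (1 + q ArmA)" and \<beta>: "\<beta> = q ArmB / (1 + q ArmB)"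
    and e0: "e 0 = y - \<beta>"
    and "\<And>k. k < h \<Longrightarrow> e (2 * k + 1) = (- q ArmA) ^ rs (Suc k) * (\<alpha> - \<beta> - e (2 * k))"
    and "\<And>k. k < h \<Longrightarrow> e (2 * k + 2) = (- q ArmB) ^ ss (Suc k) * (\<alpha> - \<beta> - e (2 * k + 1))"
  shows "pointer_prob q (block_pattern h rs ss) y = \<beta> + e (2 * h) \<and>
    pointer_sum q (block_pattern h rs ss) y
      = \<alpha> * real (\<Sum>k=1..h. rs k) + \<beta> * real (\<Sum>k=1..h. ss k)
        + (\<alpha> - \<beta>) * (real h * (\<alpha> - \<beta>) - (\<Sum>m<2*h. e (Suc m))) + \<alpha> * (e (2 * h) - e 0)"
  using assms(6,7)
proof (induction h)
  case 0
  then show ?case by (simp add: e0)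
next
  case (Suc h)
  have ih: "pointer_prob q (block_pattern h rs ss) y = \<beta> + e (2 * h)"
    "pointer_sum q (block_pattern h rs ss) y
      = \<alpha> * real (\<Sum>k=1..h. rs k) + \<beta> * real (\<Sum>k=1..h. ss k)
        + (\<alpha> - \<beta>) * (real h * (\<alpha> - \<beta>) - (\<Sum>m<2*h. e (Suc m))) + \<alpha> * (e (2 * h) - e 0)"
    using Suc.IH Suc.prems by (simp_all only: less_SucI)
  \<comment> \<open>The alternating sign convention: an A block ends at \<alpha> minus
    \<open>e\<close>, a B block at \<beta> plus \<open>e\<close>.\<close>
  have A: "pointer_prob q (replicate (rs (Suc h)) ArmA) (\<beta> + e (2 * h)) = \<alpha> - e (2 * h + 1)"
    using Suc.prems(1)[of h] assms(1) by (simp add: pointer_prob_replicate \<alpha> algebra_simps)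
  have B: "pointer_prob q (replicate (ss (Suc h)) ArmB) (\<alpha> - e (2 * h + 1)) = \<beta> + e (2 * h + 2)"
    using Suc.prems(2)[of h] assms(2) by (simp add: pointer_prob_replicate \<beta> algebra_simps)
  have SA: "pointer_sum q (replicate (rs (Suc h)) ArmA) (\<beta> + e (2 * h))
      = \<alpha> * (real (rs (Suc h)) - (\<beta> + e (2 * h)) + (\<alpha> - e (2 * h + 1)))"
    using pointer_sum_replicate[of q ArmA, OF assms(1)] unfolding A \<alpha>[symmetric] by (simp only: A)
  have SB: "pointer_sum q (replicate (ss (Suc h)) ArmB) (\<alpha> - e (2 * h + 1))
      = \<beta> * (real (ss (Suc h)) - (\<alpha> - e (2 * h + 1)) + (\<beta> + e (2 * h + 2)))"
    using pointer_sum_replicate[of q ArmB, OF assms(2)] unfolding B \<beta>[symmetric] by (simp only: B)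
  have E: "(\<Sum>m<2*Suc h. e (Suc m)) = (\<Sum>m<2*h. e (Suc m)) + e (2 * h + 1) + e (2 * h + 2)"
    by simp
  have R: "real (\<Sum>k=1..Suc h. f k) = real (\<Sum>k=1..h. f k) + real (f (Suc h))" for f :: "nat \<Rightarrow> nat"
    by simp
  have h2: "2 * Suc h = 2 * h + 2" by simp
  show ?case
    unfolding block_pattern_simps pointer_prob_simps pointer_sum_append ih A B SA SB E R
    unfolding h2 of_nat_Suc by (simp add: algebra_simps)
qed

lemma prod_blocks:
  fixes c d :: "'a::comm_ring_1" and b :: "nat \<Rightarrow> 'a"
  assumes "\<And>k. k < h \<Longrightarrow> b (2 * k + 1) = c ^ rs (Suc k)"
    and "\<And>k. k < h \<Longrightarrow> b (2 * k + 2) = d ^ ss (Suc k)"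
  shows "(\<Prod>i<2*h. b (Suc i)) = c ^ (\<Sum>k=1..h. rs k) * d ^ (\<Sum>k=1..h. ss k)"
  using assms by (induction h) (simp_all add: power_add mult_ac)

lemma prod_int_window:
  fixes b :: "int \<Rightarrow> 'a::comm_monoid_mult"
  shows "(\<Prod>i = int m..int m + int j - 1. b i) = (\<Prod>i<j. b (int (m + i)))"
  by (rule prod.reindex_bij_witness[of _ "\<lambda>i. int (m + i)" "\<lambda>i. nat i - m"]) auto

text \<open>Both sides of the comparison use the letter frequencies of \<open>D\<close>, so the
  payouts \<open>u\<close> and the loss probabilities cancel; what remains is the excess of the
  pointer sum over its single-arm values.\<close>

lemma casino_profit_eq:
  assumes "D \<noteq> []" "\<And>a. 0 < p a" "\<And>a. p a < 1" "0 \<le> y" "y \<le> 1"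
    and "pointer_prob (\<lambda>a. 1 - p a) D y = y"
    and "(\<Sum>a\<leftarrow>D. 1 - p a)
      = real (count_list D ArmA) * (1 - p ArmA) + real (count_list D ArmB) * (1 - p ArmB)"
    and "qA = 1 - p ArmA" "qB = 1 - p ArmB"
  shows "casino_profit p u D = 2 / real (length D)
    * (pointer_sum (\<lambda>a. 1 - p a) D y
       - real (count_list D ArmA) * (qA / (1 + qA)) - real (count_list D ArmB) * (qB / (1 + qB)))"
proof -
  have alg: "a / n * (x + 2 * (qA - f)) + b / n * (z + 2 * (qB - g))
      - (a / n * x + b / n * z + 2 * ((a * qA + b * qB - t) / n))
    = 2 / n * (t - a * f - b * g)" for a b n x z f g t :: real
    by (simp add: divide_inverse algebra_simps)
  have mean: "mean_payout p u [ArmA] = p ArmA * u ArmA + 2 * (qA - qA / (1 + qA))"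
    "mean_payout p u [ArmB] = p ArmB * u ArmB + 2 * (qB - qB / (1 + qB))"
    using futurity_prob_single[of p qA ArmA, OF assms(2,3,8)]
      futurity_prob_single[of p qB ArmB, OF assms(2,3,9)]
    by (simp_all add: mean_payout_def)
  show ?thesis
    unfolding casino_profit_def mean mean_payout_def[of p u D] futurity_prob_eq[OF assms(1-6)]
      assms(7) assms(8,9)[symmetric] by (rule alg)
qed

section \<open>The closed form of the profit\<close>

theorem theorem6:
  fixes p u :: "arm \<Rightarrow> real" and qA qB Q S :: real
    and h r s :: nat and rs ss :: "nat \<Rightarrow> nat"
    and b :: "int \<Rightarrow> real" and D :: "arm list"
  assumes "0 < p ArmA" "p ArmA < 1" "0 < p ArmB" "p ArmB < 1"
    and "qA = 1 - p ArmA" "qB = 1 - p ArmB"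
    and "h \<ge> 1"
    and "\<And>k. k \<in> {1..h} \<Longrightarrow> rs k \<ge> 1"
    and "\<And>k. k \<in> {1..h} \<Longrightarrow> ss k \<ge> 1"
    and "r = (\<Sum>k = 1..h. rs k)" "s = (\<Sum>k = 1..h. ss k)"
    and "D = block_pattern h rs ss"
    and "\<And>k. k \<in> {1..h} \<Longrightarrow> b (2 * int k - 1) = (- 1) ^ rs k * qA ^ rs k"
    and "\<And>k. k \<in> {1..h} \<Longrightarrow> b (2 * int k) = (- 1) ^ ss k * qB ^ ss k"
    and "\<And>i. b (i + 2 * int h) = b i"
    and "Q = real h
           + (\<Sum>m = 1..2 * h. \<Sum>j = 1..2 * h - 1.
                (- 1) ^ j * (\<Prod>i = int m..int m + int j - 1. b i))
           + real h * (\<Prod>i = 1..2 * int h. b i)"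
    and "S = (qA - qB)\<^sup>2 * (1 + (- 1) ^ (r + s) * qA ^ r * qB ^ s)
           / (real (r + s) * (1 + qA)\<^sup>2 * (1 + qB)\<^sup>2 * (1 - (qA ^ r * qB ^ s)\<^sup>2))"
  shows "casino_profit p u D = 2 * Q * S"
proof -
  define N where "N = 2 * h"
  define q where "q a = 1 - p a" for a
  have p: "0 < p a" "p a < 1" for a using assms(1-4) by (cases a; simp)+
  have q: "0 < q a" "q a < 1" for a using p[of a] by (auto simp: q_def)
  have qAB: "q ArmA = qA" "q ArmB = qB" using assms(5,6) by (simp_all add: q_def)
  have r: "1 \<le> r" using assms(7,8,10) member_le_sum[of 1 "{1..h}" rs] by force
  have D: "length D = r + s" "count_list D ArmA = r" "count_list D ArmB = s"
    "(\<Sum>a\<leftarrow>D. 1 - p a) = real r * (1 - p ArmA) + real s * (1 - p ArmB)"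
    using assms(10-12) by (simp_all add: length_block_pattern count_list_block_pattern sum_list_block_pattern)
  obtain y where y: "0 \<le> y" "y \<le> 1" "pointer_prob q D y = y"
    using pointer_prob_fixed_point[of q D] q less_imp_le by metis
  define \<alpha> \<beta> \<delta> where "\<alpha> = qA / (1 + qA)" and "\<beta> = qB / (1 + qB)" and "\<delta> = \<alpha> - \<beta>"
  define c where "c i = b (int i)" for i
  \<comment> \<open>Starts from \<beta> because, cyclically, the word is preceded by a B
    block.\<close>
  define e where "e = rec_nat (y - \<beta>) (\<lambda>m x. c (Suc m) * (\<delta> - x))"
  have e: "e 0 = y - \<beta>" "e (Suc m) = c (Suc m) * (\<delta> - e m)" for m by (simp_all add: e_def)
  have c_per: "c (i + N) = c i" for i using assms(15)[of "int i"] by (simp add: c_def N_def)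
  have cA: "c (2 * k + 1) = (- qA) ^ rs (Suc k)" if "k < h" for k
    using assms(13)[of "Suc k"] that by (simp add: c_def power_mult_distrib[symmetric] algebra_simps)
  have cB: "c (2 * k + 2) = (- qB) ^ ss (Suc k)" if "k < h" for k
    using assms(14)[of "Suc k"] that by (simp add: c_def power_mult_distrib[symmetric] algebra_simps)
  have "pointer_prob q D y = \<beta> + e (2 * h) \<and>
      pointer_sum q D y = \<alpha> * real r + \<beta> * real s
        + (\<alpha> - \<beta>) * (real h * (\<alpha> - \<beta>) - (\<Sum>m<2*h. e (Suc m))) + \<alpha> * (e (2 * h) - e 0)"
    unfolding assms(10-12)
    by (rule pointer_block_pattern)
      (use q[of ArmA] q[of ArmB] cA cB e in \<open>auto simp: qAB \<alpha>_def \<beta>_def \<delta>_def\<close>)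
  then have end_prob: "pointer_prob q D y = \<beta> + e N"
    and end_sum: "pointer_sum q D y = \<alpha> * real r + \<beta> * real s
        + \<delta> * (real h * \<delta> - (\<Sum>m<N. e (Suc m))) + \<alpha> * (e N - e 0)"
    by (simp_all only: N_def \<delta>_def)
  \<comment> \<open>The fixed point closes the recurrence into a cycle and removes the boundary term
    \<open>\<alpha> * (e N - e 0)\<close>.\<close>
  have eN: "e N = e 0" using end_prob y(3) e(1) by simp
  have T: "pointer_sum q D y = \<alpha> * real r + \<beta> * real s + \<delta> * (real h * \<delta> - (\<Sum>m<N. e (Suc m)))"
    using end_sum eN by simp
  define B where "B = (\<Prod>i<N. c i)"
  define W where "W j = (-1) ^ j * (\<Sum>m<N. \<Prod>i<j. c (Suc m + i))" for j
  have window: "(\<Prod>i<N. c (m + i)) = B" for m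
    unfolding B_def by (rule prod_window_periodic) (rule c_per)
  \<comment> \<open>The sign \<open>(-1) ^ N\<close> disappears since \<open>N = 2 * h\<close> is
    even.\<close>
  have E: "(\<Sum>m<N. e (Suc m)) * (1 - B) = - \<delta> * (\<Sum>j=1..N. W j)"
    using cyclic_affine_recurrence_sum[of c N e \<delta>, OF c_per e(2) eN]
    by (simp add: B_def W_def N_def)
  have "(\<Prod>i<2*h. c (Suc i)) = (- qA) ^ r * (- qB) ^ s"
    unfolding assms(10,11) by (rule prod_blocks) (use cA cB in auto)
  then have B: "B = (- qA) ^ r * (- qB) ^ s" using window[of 1] by (simp add: N_def)
  have "(\<Sum>m = 1..2 * h. \<Sum>j = 1..2 * h - 1. (- 1) ^ j * (\<Prod>i = int m..int m + int j - 1. b i))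
      = (\<Sum>m<N. \<Sum>j=1..N-1. (-1) ^ j * (\<Prod>i<j. c (Suc m + i)))"
    unfolding prod_int_window c_def[symmetric] N_def
    by (rule sum.reindex_bij_witness[of _ Suc "\<lambda>m. m - 1"]) auto
  also have "\<dots> = (\<Sum>j=1..N-1. W j)"
    by (subst sum.swap) (simp add: W_def sum_distrib_left)
  \<comment> \<open>\<open>Q\<close> stops at windows of length \<open>N - 1\<close>, whereas
    \<open>E\<close> includes the full cycle. The full-length term contributes \<open>N\<close>
    equal products, so altogether \<open>Q = h * (1 - B) + (\<Sum>j=1..N. W j)\<close>.\<close>
  also have "\<dots> = (\<Sum>j=1..N. W j) - W N"
    using assms(7) by (cases N) (auto simp: N_def)
  also have "W N = 2 * real h * B"
    by (simp only: W_def window) (simp add: N_def)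
  finally have Q: "Q = real h + ((\<Sum>j=1..N. W j) - 2 * real h * B) + real h * B"
    using prod_int_window[of b 1 N] window[of 1] unfolding assms(16)
    by (simp add: c_def N_def)
  define x where "x = qA ^ r * qB ^ s"
  have x: "0 < x" "x < 1"
  proof -
    have "qA ^ r < 1" using r q[of ArmA] by (auto simp: qAB intro: power_Suc_less_one power_less_one_iff[THEN iffD2])
    moreover have "qB ^ s \<le> 1" "0 < qB ^ s" using q[of ArmB] by (auto simp: qAB intro: power_le_one)
    moreover have "0 < qA ^ r" using q[of ArmA] by (simp add: qAB)
    ultimately have "0 < x" "x \<le> qA ^ r"
      unfolding x_def by (auto intro: mult_left_le mult_pos_pos)
    then show "0 < x" "x < 1" using \<open>qA ^ r < 1\<close> by auto
  qed
  have Bx: "B = (-1) ^ (r + s) * x"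
    unfolding B x_def power_add power_minus[of qA] power_minus[of qB] by simp
  have B2: "B\<^sup>2 = x\<^sup>2" unfolding Bx by (simp add: power_mult_distrib flip: power_mult)
  have "\<bar>B\<bar> < 1" unfolding Bx using x by (simp add: abs_mult power_abs)
  then have B1: "1 - B \<noteq> 0" "1 + B \<noteq> 0" by auto
  \<comment> \<open>Multiplying by \<open>1 - B\<close> and inserting \<open>E\<close> leaves
    \<delta> times exactly that expression for \<open>Q\<close>.\<close>
  have hE: "real h * \<delta> - (\<Sum>m<N. e (Suc m)) = \<delta> * Q / (1 - B)"
    using E B1(1) unfolding Q by (simp add: field_simps)
  have \<delta>: "\<delta> = (qA - qB) / ((1 + qA) * (1 + qB))"
    using q[of ArmA] q[of ArmB] by (simp add: \<delta>_def \<alpha>_def \<beta>_def qAB field_simps)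
  \<comment> \<open>The numerator factor \<open>1 + (-1) ^ (r + s) * x\<close> of \<open>S\<close>
    is \<open>1 + B\<close>, which cancels against this factorization.\<close>
  have "1 - x\<^sup>2 = (1 - B) * (1 + B)" unfolding B2[symmetric] by (simp add: power2_eq_square algebra_simps)
  then have "S = \<delta>\<^sup>2 * (1 + B) / (real (r + s) * ((1 - B) * (1 + B)))"
    unfolding assms(17) by (simp add: Bx x_def \<delta> power_divide power_mult_distrib mult_ac)
  then have S: "S = \<delta>\<^sup>2 / (real (r + s) * (1 - B))" using B1 by simp
  have "D \<noteq> []" using D(1) r by auto
  then have "casino_profit p u D
    = 2 / real (r + s) * (pointer_sum q D y - real r * \<alpha> - real s * \<beta>)"
    using casino_profit_eq[of D p y qA qB u] D p y assms(5,6)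
    by (auto simp: q_def[abs_def] \<alpha>_def \<beta>_def)
  also have "\<dots> = 2 / real (r + s) * (\<delta> * (\<delta> * Q / (1 - B)))"
    unfolding T hE by (simp add: algebra_simps)
  also have "\<dots> = 2 * Q * S"
    unfolding S by (simp add: power2_eq_square)
  finally show ?thesis .
qed

end
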